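(* Let $P$ and $Q$ be LPMLN programs that contain no hard rules. Then $P$ and $Q$ are p-uniformly equivalent if and only if $\mathrm{UE}(P)=\mathrm{UE}(Q)$ and there exists a real number $c$ such that for every UE-model $(X,Y)\in\mathrm{UE}(P)$, $W(P,(X,Y))=c\cdot W(Q,(X,Y))$.
   Context: All programs are finite and ground. A literal is an atom $a$ or its classical negation $\neg a$. An ASP rule $r$ has the form $l_1\vee\cdots\vee l_k\leftarrow l_{k+1},\dots,l_m,\ not\ l_{m+1},\dots,\ not\ l_n$ with literals $l_i$; $h(r)$, $b^+(r)$, $b^-(r)$ are the head, positive body and negative body literal sets; $r$ is a fact if $b^+(r)=b^-(r)=\emptyset$. An interpretation is a set of literals not containing both $a$ and $\neg a$ for any atom $a$. $I\models r$ iff ($b^+(r)\subseteq I$ and $b^-(r)\cap I=\emptyset$) implies $h(r)\cap I\neq\emptyset$. For an ASP program $\Pi$ the GL-reduct is $\Pi^I=\{h(r)\leftarrow b^+(r) : r\in\Pi,\ b^-(r)\cap I=\emptyset\}$, and $I$ is a stable model of $\Pi$ iff $I\models\Pi^I$ and no proper subset of $I$ satisfies $\Pi^I$. An LPMLN program $P$ is a finite set of weighted rules $w:r$, $r$ an ASP rule, $w$ either a real number (soft rule) or the symbol $\alpha$ (hard rule); a weighted fact is $w:r$ with $r$ a fact; $\overline{P}=\{r: w:r\in P\}$. $P_I=\{w:r\in P : I\models r\}$; $I$ is a stable model of $P$ iff it is a stable model of $\overline{P_I}$; $\mathrm{SM}(P)$ is the set of stable models. $W(P,I)=\exp(\sum_{w:r\in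 P_I}w)$ (a formal expression in $\alpha$ if hard rules occur), and $Pr(P,I)=\lim_{\alpha\to\infty}W(P,I)/\sum_{I'\in\mathrm{SM}(P)}W(P,I')$ if $I\in\mathrm{SM}(P)$, else $0$. $P,Q$ are p-uniformly equivalent iff for every finite set $R$ of weighted facts, $\mathrm{SM}(P\cup R)=\mathrm{SM}(Q\cup R)$ and $Pr(P\cup R,X)=Pr(Q\cup R,X)$ for all $X\in\mathrm{SM}(P\cup R)$. An SE-interpretation is a pair $(X,Y)$ of interpretations with $X\subseteq Y$; it is an SE-model of $P$ iff $X\models(\overline{P_Y})^Y$; $\mathrm{SE}(P)$ is their set; $W(P,(X,Y))=W(P,Y)$. A UE-model of $P$ is an SE-model $(X,Y)$ of $P$ such that either $X=Y$, or $X\subset Y$ and there is no interpretation $X'$ with $X\subset X'\subset Y$ and $(X',Y)\in\mathrm{SE}(P)$; $\mathrm{UE}(P)$ is their set.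
   Formalization: Programs are finite multisets of weighted rules and P ∪ R adds multiplicities; with plain set union the claim fails: P={1:a}, Q={0.4:a, 0.6:a}, R={1:a}. *)

theory Defs
  imports Complex_Main "HOL-Library.FSet" "HOL-Library.Multiset"
begin

section \<open>Answer set programs with disjunctive heads and classical negation\<close>

datatype 'a literal = Atom 'a | CNeg 'a

type_synonym 'a interp = "'a literal set"

definition interpretation_set :: "'a interp \<Rightarrow> bool" where
  "interpretation_set I \<longleftrightarrow> (\<nexists>a. Atom a \<in> I \<and> CNeg a \<in> I)"

datatype 'a rule =
  Rule (head: "'a literal fset") (pbody: "'a literal fset") (nbody: "'a literal fset")

definition is_fact :: "'a rule \<Rightarrow> bool" where
  "is_fact r \<longleftrightarrow> pbody r = {||} \<and> nbody r = {||}"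

definition sat_rule :: "'a interp \<Rightarrow> 'a rule \<Rightarrow> bool" where
  "sat_rule I r \<longleftrightarrow>
     (fset (pbody r) \<subseteq> I \<and> fset (nbody r) \<inter> I = {} \<longrightarrow> fset (head r) \<inter> I \<noteq> {})"

definition sat_asp :: "'a interp \<Rightarrow> 'a rule set \<Rightarrow> bool" where
  "sat_asp I \<Pi> \<longleftrightarrow> (\<forall>r\<in>\<Pi>. sat_rule I r)"

definition reduct :: "'a rule set \<Rightarrow> 'a interp \<Rightarrow> 'a rule set" where
  "reduct \<Pi> I = {Rule (head r) (pbody r) {||} | r. r \<in> \<Pi> \<and> fset (nbody r) \<inter> I = {}}"

definition asp_stable_model :: "'a interp \<Rightarrow> 'a rule set \<Rightarrow> bool" where
  "asp_stable_model I \<Pi> \<longleftrightarrow>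
     interpretation_set I \<and> sat_asp I (reduct \<Pi> I) \<and> (\<forall>J. J \<subset> I \<longrightarrow> \<not> sat_asp J (reduct \<Pi> I))"

section \<open>LPMLN programs\<close>

text \<open>\<open>Hard\<close> is the symbolic weight \<open>\<alpha>\<close>.\<close>

datatype weight = Soft real | Hard

text \<open>
  Programs are finite collections of weighted rules \<^emph>\<open>counted with multiplicity\<close>, and
  the extension of a program \<open>P\<close> by a program \<open>R\<close> is the additive union \<open>P + R\<close>.  This
  is what makes weights multiplicative, \<open>W(P \<union> R, I) = W(P, I) * W(R, I)\<close>: a weighted
  rule of \<open>R\<close> must not be absorbed because the same weighted rule is already in \<open>P\<close>.
  With a collapsing union the characterization of p-uniform equivalence by UE-models
  is false: \<open>P = {1 : a}\<close> and \<open>Q = {0.4 : a, 0.6 : a}\<close> have the same UE-models and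
  the same weights, but after adding \<open>R = {1 : a}\<close> the stable model \<open>{a}\<close> would have
  weight \<open>e\<close> in the one case and \<open>e\<^sup>2\<close> in the other, while \<open>{}\<close> has weight \<open>1\<close> in both.
  If \<open>P\<close> and \<open>R\<close> are disjoint sets, \<open>P + R\<close> is their ordinary union.
\<close>

type_synonym 'a program = "(weight \<times> 'a rule) multiset"

definition rules :: "'a program \<Rightarrow> 'a rule set" where
  "rules P = snd ` set_mset P"

definition no_hard_rules :: "'a program \<Rightarrow> bool" where
  "no_hard_rules P \<longleftrightarrow> (\<forall>(w, r)\<in>#P. w \<noteq> Hard)"

definition weighted_facts :: "'a program \<Rightarrow> bool" where
  "weighted_facts R \<longleftrightarrow> (\<forall>(w, r)\<in>#R. is_fact r)"

definition satisfied_part :: "'a program \<Rightarrow> 'a interp \<Rightarrow> 'a program" where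
  "satisfied_part P I = filter_mset (\<lambda>(w, r). sat_rule I r) P"

definition SM :: "'a program \<Rightarrow> 'a interp set" where
  "SM P = {I. asp_stable_model I (rules (satisfied_part P I))}"

fun weight_value :: "real \<Rightarrow> weight \<Rightarrow> real" where
  "weight_value \<alpha> (Soft w) = w"
| "weight_value \<alpha> Hard = \<alpha>"

text \<open>
  The formal expression \<open>W(P, I)\<close> is represented by the function of \<open>\<alpha>\<close> it denotes;
  it is constant in \<open>\<alpha>\<close> when \<open>P\<close> has no hard rules.
\<close>

definition W :: "'a program \<Rightarrow> 'a interp \<Rightarrow> real \<Rightarrow> real" where
  "W P I \<alpha> = exp (\<Sum>(w, r)\<in>#satisfied_part P I. weight_value \<alpha> w)"

text \<open>
  A stable model contains only literals from rule heads, so \<open>SM P\<close> is finite and the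
  sum below is a genuine one.
\<close>

definition Pr :: "'a program \<Rightarrow> 'a interp \<Rightarrow> real" where
  "Pr P I = (if I \<in> SM P
     then Lim at_top (\<lambda>\<alpha>. W P I \<alpha> / (\<Sum>I'\<in>SM P. W P I' \<alpha>))
     else 0)"

definition p_uniformly_equivalent :: "'a program \<Rightarrow> 'a program \<Rightarrow> bool" where
  "p_uniformly_equivalent P Q \<longleftrightarrow>
     (\<forall>R. weighted_facts R \<longrightarrow>
        SM (P + R) = SM (Q + R) \<and> (\<forall>X\<in>SM (P + R). Pr (P + R) X = Pr (Q + R) X))"

section \<open>SE-models and UE-models\<close>

definition SE :: "'a program \<Rightarrow> ('a interp \<times> 'a interp) set" where
  "SE P = {(X, Y). interpretation_set X \<and> interpretation_set Y \<and> X \<subseteq> Y \<and>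
     sat_asp X (reduct (rules (satisfied_part P Y)) Y)}"

definition W_SE :: "'a program \<Rightarrow> 'a interp \<times> 'a interp \<Rightarrow> real \<Rightarrow> real" where
  "W_SE P M = W P (snd M)"

definition UE :: "'a program \<Rightarrow> ('a interp \<times> 'a interp) set" where
  "UE P = {(X, Y). (X, Y) \<in> SE P \<and>
     (X = Y \<or> X \<subset> Y \<and>
       (\<nexists>X'. interpretation_set X' \<and> X \<subset> X' \<and> X' \<subset> Y \<and> (X', Y) \<in> SE P))}"

end

theory Submission
  imports Defs
begin

text \<open>
  An interpretation \<open>Y\<close> fails to be a stable model of \<open>P + R\<close>, for weighted facts \<open>R\<close>, iff some
  \<open>(J, Y) \<in> SE P\<close> with \<open>J \<subset> Y\<close> satisfies the facts of \<open>R\<close> that hold in \<open>Y\<close>.  Satisfaction of facts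
  is monotone in \<open>J\<close>, so only the maximal \<open>J\<close>, i.e. the UE-models, matter.  Conversely, adding
  the facts \<open>X\<close> with weight 0 tests whether \<open>Y\<close> has an SE-model between \<open>X\<close> and \<open>Y\<close>, which
  recovers the UE-models.  Adding the facts \<open>Y\<close> with weight 0 makes both \<open>{}\<close> and \<open>Y\<close> stable, and
  comparing their probabilities shows that \<open>W(P, Y) / W(Q, Y)\<close> equals \<open>W(P, {}) / W(Q, {})\<close>.

  Interpretations may be infinite, but \<open>(X, Y) \<in> SE P\<close> depends only on the traces of \<open>X\<close> and \<open>Y\<close> on
  the finitely many literals that occur in \<open>P\<close>.
\<close>

section \<open>Satisfaction of the reduct and its locality\<close>

definition program_literals :: "'a program \<Rightarrow> 'a literal set" where
  "program_literals P = (\<Union>r\<in>rules P. fset (head r) \<union> fset (pbody r) \<union> fset (nbody r))"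

text \<open>The condition common to stable models and SE-models, stated for arbitrary sets and
  without \<open>X \<subseteq> Y\<close>, so that it splits over \<open>P + R\<close>.\<close>

definition reduct_model :: "'a program \<Rightarrow> 'a interp \<Rightarrow> 'a interp \<Rightarrow> bool" where
  "reduct_model P X Y \<longleftrightarrow> sat_asp X (reduct (rules (satisfied_part P Y)) Y)"

lemma finite_program_literals: "finite (program_literals P)"
  by (simp add: program_literals_def rules_def)

lemma rules_satisfied_part: "rules (satisfied_part P Y) = {r \<in> rules P. sat_rule Y r}"
  by (force simp: rules_def satisfied_part_def)

lemma reduct_model_iff:
  "reduct_model P X Y \<longleftrightarrow>
     (\<forall>r\<in>rules P. sat_rule Y r \<and> fset (nbody r) \<inter> Y = {} \<and> fset (pbody r) \<subseteq> X \<longrightarrow>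
        fset (head r) \<inter> X \<noteq> {})"
proof -
  have "sat_asp X (reduct \<Pi> Y) \<longleftrightarrow>
      (\<forall>r\<in>\<Pi>. fset (nbody r) \<inter> Y = {} \<longrightarrow> sat_rule X (Rule (head r) (pbody r) {||}))" for \<Pi>
    unfolding sat_asp_def reduct_def by blast
  then show ?thesis
    by (auto simp: reduct_model_def rules_satisfied_part sat_rule_def[of X])
qed

lemma sat_rule_Int:
  assumes "fset (head r) \<union> fset (pbody r) \<union> fset (nbody r) \<subseteq> L"
  shows "sat_rule (Y \<inter> L) r \<longleftrightarrow> sat_rule Y r"
proof -
  have "fset (head r) \<inter> (Y \<inter> L) = fset (head r) \<inter> Y"
    "fset (nbody r) \<inter> (Y \<inter> L) = fset (nbody r) \<inter> Y"
    "fset (pbody r) \<subseteq> Y \<inter> L \<longleftrightarrow> fset (pbody r) \<subseteq> Y"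
    using assms by auto
  then show ?thesis by (simp add: sat_rule_def)
qed

lemma reduct_model_Int:
  assumes "program_literals P \<subseteq> L"
  shows "reduct_model P (X \<inter> L) (Y \<inter> L) \<longleftrightarrow> reduct_model P X Y"
proof -
  have "sat_rule (Y \<inter> L) r \<longleftrightarrow> sat_rule Y r"
    "fset (head r) \<inter> (X \<inter> L) = fset (head r) \<inter> X"
    "fset (nbody r) \<inter> (Y \<inter> L) = fset (nbody r) \<inter> Y"
    "fset (pbody r) \<subseteq> X \<inter> L \<longleftrightarrow> fset (pbody r) \<subseteq> X"
    if "r \<in> rules P" for r
  proof -
    have r: "fset (head r) \<union> fset (pbody r) \<union> fset (nbody r) \<subseteq> L"
      using assms that by (auto simp: program_literals_def)
    show "sat_rule (Y \<inter> L) r \<longleftrightarrow> sat_rule Y r"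
      by (rule sat_rule_Int[OF r])
    show "fset (head r) \<inter> (X \<inter> L) = fset (head r) \<inter> X"
      "fset (nbody r) \<inter> (Y \<inter> L) = fset (nbody r) \<inter> Y"
      "fset (pbody r) \<subseteq> X \<inter> L \<longleftrightarrow> fset (pbody r) \<subseteq> X"
      using r by auto
  qed
  then show ?thesis by (simp add: reduct_model_iff)
qed

lemma reduct_model_cong:
  assumes "program_literals P \<subseteq> L" "X \<inter> L = X' \<inter> L" "Y \<inter> L = Y' \<inter> L"
  shows "reduct_model P X Y \<longleftrightarrow> reduct_model P X' Y'"
  using reduct_model_Int[OF assms(1)] assms(2,3) by metis

text \<open>\<open>satisfied_part\<close> keeps only rules that hold in \<open>Y\<close>. Hence
  stability of an interpretation reduces to minimality.\<close>

lemma reduct_model_refl: "reduct_model P Y Y"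
  by (auto simp: reduct_model_iff sat_rule_def)

lemma reduct_model_plus:
  "reduct_model (P + R) X Y \<longleftrightarrow> reduct_model P X Y \<and> reduct_model R X Y"
  by (auto simp: reduct_model_iff rules_def)

text \<open>A fact has no body, so a larger set can only meet its head more easily.\<close>

lemma reduct_model_facts_mono:
  assumes "weighted_facts R" "reduct_model R X Y" "X \<subseteq> X'"
  shows "reduct_model R X' Y"
  using assms by (fastforce simp: reduct_model_iff weighted_facts_def is_fact_def rules_def)

section \<open>Stable models, SE-models and UE-models\<close>

lemma interpretation_set_subset: "interpretation_set Y \<Longrightarrow> X \<subseteq> Y \<Longrightarrow> interpretation_set X"
  by (auto simp: interpretation_set_def)

lemma SM_iff: "X \<in> SM P \<longleftrightarrow> interpretation_set X \<and> (\<forall>J\<subset>X. \<not> reduct_model P J X)"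
  using reduct_model_refl[of P X]
  by (auto simp: SM_def asp_stable_model_def reduct_model_def)

lemma SE_iff: "(X, Y) \<in> SE P \<longleftrightarrow> interpretation_set Y \<and> X \<subseteq> Y \<and> reduct_model P X Y"
  by (auto simp: SE_def reduct_model_def intro: interpretation_set_subset)

lemma UE_iff:
  "(X, Y) \<in> UE P \<longleftrightarrow> (X, Y) \<in> SE P \<and> (\<forall>X'. X \<subset> X' \<and> X' \<subset> Y \<longrightarrow> \<not> reduct_model P X' Y)"
  by (auto simp: UE_def SE_iff intro: interpretation_set_subset)

lemma UE_refl: "interpretation_set Y \<Longrightarrow> (Y, Y) \<in> UE P"
  by (auto simp: UE_iff SE_iff reduct_model_refl)

lemma SM_subset_program_literals:
  assumes "X \<in> SM P"
  shows "X \<subseteq> program_literals P"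
proof (rule ccontr)
  let ?J = "X \<inter> program_literals P"
  assume "\<not> ?thesis"
  then have "?J \<subset> X" by blast
  moreover have "reduct_model P ?J X"
    using reduct_model_cong[of P "program_literals P" ?J X X X]
    by (simp add: reduct_model_refl Int_assoc)
  ultimately show False using assms by (simp add: SM_iff)
qed

lemma finite_SM: "finite (SM P)"
  by (rule finite_subset[of _ "Pow (program_literals P)"])
    (auto simp: finite_program_literals dest: SM_subset_program_literals)

lemma SE_extends_to_UE:
  assumes "(X, Y) \<in> SE P" "X \<subset> Y"
  obtains M where "X \<subseteq> M" "M \<subset> Y" "(M, Y) \<in> UE P"
proof -
  let ?L = "program_literals P"
  \<comment> \<open>Withholding \<open>l\<close> from \<open>X0\<close> keeps it strictly below
    \<open>Y\<close>, even if \<open>X\<close> and \<open>Y\<close> agree on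
    \<open>?L\<close>.\<close>
  obtain l where l: "l \<in> Y" "l \<notin> X" using assms(2) by blast
  \<comment> \<open>Adding these irrelevant literals to \<open>X\<close> leaves only finitely many sets up to \<open>Y\<close>.\<close>
  define X0 where "X0 = X \<union> (Y - insert l ?L)"
  have X0: "X \<subseteq> X0" "X0 \<subset> Y" "X0 \<inter> ?L = X \<inter> ?L"
    using l assms(2) by (auto simp: X0_def)
  define \<S> where "\<S> = {X'. X0 \<subseteq> X' \<and> X' \<subset> Y \<and> reduct_model P X' Y}"
  \<comment> \<open>A member of \<open>\<S>\<close> is determined by what it omits from
    \<open>Y\<close>, which lies in a finite set; so a maximal member exists.\<close>
  have "\<S> \<subseteq> (\<lambda>D. Y - D) ` Pow (insert l ?L)"
  proof
    fix X' assume "X' \<in> \<S>"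
    then have "X' = Y - (Y - X')" "Y - X' \<subseteq> insert l ?L"
      by (auto simp: \<S>_def X0_def)
    then show "X' \<in> (\<lambda>D. Y - D) ` Pow (insert l ?L)" by blast
  qed
  then have "finite \<S>"
    by (rule finite_subset) (simp add: finite_program_literals)
  moreover have "X0 \<in> \<S>"
    using X0 assms(1) reduct_model_cong[of P ?L X0 X Y Y] by (simp add: \<S>_def SE_iff)
  ultimately obtain M where M: "M \<in> \<S>" "\<And>X'. X' \<in> \<S> \<Longrightarrow> M \<subseteq> X' \<Longrightarrow> M = X'"
    using finite_has_maximal[of \<S>] by blast
  have "(M, Y) \<in> UE P"
    unfolding UE_iff
  proof (intro conjI allI impI notI)
    show "(M, Y) \<in> SE P" using M(1) assms(1) by (auto simp: \<S>_def SE_iff)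
    fix X' assume X': "M \<subset> X' \<and> X' \<subset> Y" "reduct_model P X' Y"
    then have "X' \<in> \<S>" using M(1) by (auto simp: \<S>_def)
    then show False using M(2)[of X'] X' by blast
  qed
  moreover have "X \<subseteq> M" "M \<subset> Y" using M(1) X0(1) by (auto simp: \<S>_def)
  ultimately show ?thesis by (rule that[rotated 2])
qed

text \<open>The right-hand side depends on \<open>P\<close> only through \<open>UE P\<close>, so
  equal UE-models give equal stable models under every extension by facts.\<close>

lemma SM_plus_facts_iff:
  assumes "weighted_facts R"
  shows "Y \<in> SM (P + R) \<longleftrightarrow>
    interpretation_set Y \<and> (\<forall>X\<subset>Y. (X, Y) \<in> UE P \<longrightarrow> \<not> reduct_model R X Y)"
proof (cases "interpretation_set Y")
  case True
  have "\<exists>M\<subset>Y. (M, Y) \<in> UE P \<and> reduct_model R M Y"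
    if J: "J \<subset> Y" "reduct_model P J Y" "reduct_model R J Y" for J
  proof -
    have "(J, Y) \<in> SE P" using J True by (auto simp: SE_iff)
    then obtain M where "J \<subseteq> M" "M \<subset> Y" "(M, Y) \<in> UE P"
      using SE_extends_to_UE J(1) by blast
    then show ?thesis using reduct_model_facts_mono[OF assms J(3)] by blast
  qed
  moreover have "reduct_model P M Y" if "(M, Y) \<in> UE P" for M
    using that by (simp add: UE_iff SE_iff)
  ultimately show ?thesis
    unfolding SM_iff reduct_model_plus using True by metis
qed (simp add: SM_iff)

section \<open>Weights, test facts and probabilities\<close>

lemma satisfied_part_plus: "satisfied_part (P + R) X = satisfied_part P X + satisfied_part R X"
  by (simp add: satisfied_part_def)

lemma W_plus: "W (P + R) X \<alpha> = W P X \<alpha> * W R X \<alpha>"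
  by (simp add: W_def satisfied_part_plus exp_add)

lemma W_pos: "W P X \<alpha> > 0"
  by (simp add: W_def)

lemma W_no_hard_rules:
  assumes "no_hard_rules P"
  shows "W P X \<alpha> = W P X 0"
proof -
  have "weight_value \<alpha> w = weight_value 0 w" if "(w, r) \<in># P" for w r
    using assms that by (cases w) (auto simp: no_hard_rules_def)
  then show ?thesis
    unfolding W_def satisfied_part_def
    by (intro arg_cong[where f = exp] arg_cong[where f = sum_mset] image_mset_cong) auto
qed

lemma W_cong:
  assumes "program_literals P \<subseteq> L" "Y \<inter> L = Y' \<inter> L"
  shows "W P Y \<alpha> = W P Y' \<alpha>"
proof -
  have "sat_rule Y r \<longleftrightarrow> sat_rule Y' r" if "(w, r) \<in># P" for w r
  proof -
    have "fset (head r) \<union> fset (pbody r) \<union> fset (nbody r) \<subseteq> L"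
      using assms(1) that by (force simp: program_literals_def rules_def)
    then show ?thesis using sat_rule_Int assms(2) by metis
  qed
  then have "satisfied_part P Y = satisfied_part P Y'"
    unfolding satisfied_part_def by (intro filter_mset_cong) auto
  then show ?thesis by (simp add: W_def)
qed

text \<open>Weight 0 contributes a factor 1 to \<open>W\<close>, so these facts alter the stable
  models but no weight. For infinite \<open>A\<close>, \<open>mset_set A\<close> is empty.\<close>

definition zero_facts :: "'a literal set \<Rightarrow> 'a program" where
  "zero_facts A = image_mset (\<lambda>l. (Soft 0, Rule {|l|} {||} {||})) (mset_set A)"

lemma weighted_facts_zero_facts: "weighted_facts (zero_facts A)"
  by (auto simp: weighted_facts_def zero_facts_def is_fact_def)

lemma no_hard_rules_zero_facts: "no_hard_rules (zero_facts A)"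
  by (auto simp: no_hard_rules_def zero_facts_def)

lemma W_zero_facts: "W (zero_facts A) X \<alpha> = 1"
  by (auto simp: W_def zero_facts_def satisfied_part_def filter_mset_image_mset
      image_mset.compositionality comp_def)

text \<open>Facts for literals outside \<open>Y\<close> fail in \<open>Y\<close> and leave the
  satisfied part; hence \<open>A \<inter> Y\<close>.\<close>

lemma reduct_model_zero_facts:
  "finite A \<Longrightarrow> reduct_model (zero_facts A) X Y \<longleftrightarrow> A \<inter> Y \<subseteq> X"
  by (auto simp: reduct_model_iff rules_def zero_facts_def sat_rule_def)

lemma Pr_no_hard_rules:
  assumes "no_hard_rules P" "X \<in> SM P"
  shows "Pr P X = W P X 0 / (\<Sum>I\<in>SM P. W P I 0)"
proof -
  have "(\<lambda>\<alpha>. W P X \<alpha> / (\<Sum>I\<in>SM P. W P I \<alpha>)) = (\<lambda>\<alpha>. W P X 0 / (\<Sum>I\<in>SM P. W P I 0))"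
    by (subst (1 2) W_no_hard_rules[OF assms(1)]) (rule refl)
  then have "Pr P X = Lim at_top (\<lambda>\<alpha>::real. W P X 0 / (\<Sum>I\<in>SM P. W P I 0))"
    using assms(2) by (simp only: Pr_def if_True)
  also have "\<dots> = W P X 0 / (\<Sum>I\<in>SM P. W P I 0)"
    by (rule tendsto_Lim) auto
  finally show ?thesis .
qed

text \<open>The common normalising sum is positive and cancels.\<close>

lemma Pr_ratio:
  assumes "no_hard_rules P" "X \<in> SM P" "Y \<in> SM P"
  shows "Pr P X / Pr P Y = W P X 0 / W P Y 0"
proof -
  have "(\<Sum>I\<in>SM P. W P I 0) > 0"
    using assms(2) by (intro sum_pos finite_SM W_pos) auto
  then show ?thesis by (simp add: Pr_no_hard_rules assms)
qed

section \<open>From p-uniform equivalence to UE-models and weights\<close>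

lemma
  assumes "p_uniformly_equivalent P Q" "weighted_facts R"
  shows p_uniformly_equivalent_SM: "SM (P + R) = SM (Q + R)"
    and p_uniformly_equivalent_Pr: "X \<in> SM (P + R) \<Longrightarrow> Pr (P + R) X = Pr (Q + R) X"
  using assms unfolding p_uniformly_equivalent_def by blast+

lemma p_uniformly_equivalent_sym:
  "p_uniformly_equivalent P Q \<Longrightarrow> p_uniformly_equivalent Q P"
  by (simp add: p_uniformly_equivalent_def)

lemma p_uniformly_equivalent_SE_between:
  assumes eq: "p_uniformly_equivalent P Q" and XY: "(X, Y) \<in> SE P" "X \<subset> Y"
  obtains J where "X \<subseteq> J" "J \<subset> Y" "(J, Y) \<in> SE Q"
proof -
  define L where "L = program_literals P \<union> program_literals Q"
  have L: "finite L" "program_literals P \<subseteq> L" "program_literals Q \<subseteq> L"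
    by (auto simp: L_def finite_program_literals)
  have Y: "interpretation_set Y" "interpretation_set (Y \<inter> L)"
    using XY by (auto simp: SE_iff intro: interpretation_set_subset)
  show ?thesis
  proof (cases "X \<inter> L = Y \<inter> L")
    case True
    then have "reduct_model Q X Y"
      using reduct_model_cong[OF L(3) True, of Y Y] by (simp add: reduct_model_refl)
    then show ?thesis using XY Y that[of X] by (auto simp: SE_iff)
  next
    case False
    let ?R = "zero_facts (X \<inter> L)"
    have R: "reduct_model ?R J (Y \<inter> L) \<longleftrightarrow> X \<inter> L \<subseteq> J" for J
      using XY(2) L(1) by (subst reduct_model_zero_facts) auto
    have SM: "Y \<inter> L \<in> SM (P' + ?R) \<longleftrightarrow>
        \<not> (\<exists>J. J \<subset> Y \<inter> L \<and> reduct_model P' J (Y \<inter> L) \<and> X \<inter> L \<subseteq> J)" for P'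
      unfolding SM_iff reduct_model_plus R using Y(2) by metis
    have "reduct_model P (X \<inter> L) (Y \<inter> L)"
      using XY(1) reduct_model_Int[OF L(2)] by (auto simp: SE_iff)
    moreover have "X \<inter> L \<subset> Y \<inter> L" using False XY(2) by blast
    ultimately have "Y \<inter> L \<notin> SM (P + ?R)"
      unfolding SM by blast
    then have "Y \<inter> L \<notin> SM (Q + ?R)"
      by (simp add: p_uniformly_equivalent_SM[OF eq weighted_facts_zero_facts])
    then obtain J where J: "J \<subset> Y \<inter> L" "reduct_model Q J (Y \<inter> L)" "X \<inter> L \<subseteq> J"
      unfolding SM by metis
    \<comment> \<open>Restoring all of \<open>Y\<close> outside \<open>L\<close> puts
      \<open>?J\<close> above \<open>X\<close>, keeps it strictly below \<open>Y\<close>, and is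
      invisible to \<open>Q\<close>.\<close>
    let ?J = "J \<union> (Y - L)"
    have "reduct_model Q ?J Y"
      using J(1,2) reduct_model_cong[OF L(3), of J ?J "Y \<inter> L" Y] by blast
    moreover have "X \<subseteq> ?J" "?J \<subset> Y" using J XY(2) by auto
    ultimately show ?thesis using that[of ?J] Y by (auto simp: SE_iff)
  qed
qed

text \<open>Passing from \<open>P\<close> to \<open>Q\<close> and back gives
  \<open>X \<subseteq> J \<subseteq> M \<subseteq> J' \<subset> Y\<close> with \<open>(M, Y)\<close>
  in \<open>UE Q\<close> and \<open>(J', Y)\<close> in \<open>SE P\<close>. Maximality of
  \<open>X\<close> collapses the chain to \<open>M = X\<close>.\<close>

lemma p_uniformly_equivalent_UE_subset:
  assumes "p_uniformly_equivalent P Q"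
  shows "UE P \<subseteq> UE Q"
proof clarify
  fix X Y assume UE: "(X, Y) \<in> UE P"
  then have SE: "(X, Y) \<in> SE P" by (simp add: UE_iff)
  show "(X, Y) \<in> UE Q"
  proof (cases "X = Y")
    case True
    then show ?thesis using SE UE_refl[of Y Q] by (simp add: SE_iff)
  next
    case False
    then have "X \<subset> Y" using SE by (auto simp: SE_iff)
    then obtain J where J: "X \<subseteq> J" "J \<subset> Y" "(J, Y) \<in> SE Q"
      using p_uniformly_equivalent_SE_between[OF assms SE] by blast
    then obtain M where M: "J \<subseteq> M" "M \<subset> Y" "(M, Y) \<in> UE Q"
      using SE_extends_to_UE[OF J(3,2)] by metis
    then obtain J' where J': "M \<subseteq> J'" "J' \<subset> Y" "(J', Y) \<in> SE P"
      using p_uniformly_equivalent_SE_between[OF p_uniformly_equivalent_sym[OF assms], of M Y]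
      by (metis UE_iff)
    have "\<not> X \<subset> J'" using UE J' by (metis UE_iff SE_iff)
    then have "M = X" using J(1) M(1) J'(1) by blast
    then show ?thesis using M(3) by simp
  qed
qed

lemma p_uniformly_equivalent_weight_ratio:
  assumes eq: "p_uniformly_equivalent P Q"
    and soft: "no_hard_rules P" "no_hard_rules Q" and Y: "interpretation_set Y"
  shows "W P Y 0 = W P {} 0 / W Q {} 0 * W Q Y 0"
proof -
  define L where "L = program_literals P \<union> program_literals Q"
  have L: "finite L" "program_literals P \<subseteq> L" "program_literals Q \<subseteq> L"
    by (auto simp: L_def finite_program_literals)
  \<comment> \<open>Only finitely many facts can be added, so \<open>Y\<close> is cut down to
    \<open>L\<close>; \<open>W_cong\<close> transfers the result back to \<open>Y\<close>.\<close>
  let ?Y = "Y \<inter> L"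
  let ?R = "zero_facts ?Y"
  have intp: "interpretation_set ?Y" "interpretation_set ({} :: 'a interp)"
    using Y by (auto simp: interpretation_set_def)
  have "\<not> reduct_model ?R J ?Y" if "J \<subset> ?Y" for J
    using that L(1) by (subst reduct_model_zero_facts) auto
  \<comment> \<open>A proper subset of \<open>?Y\<close> misses one of the facts, and
    \<open>{}\<close> has no proper subset.\<close>
  then have SM: "?Y \<in> SM (P' + ?R)" "{} \<in> SM (P' + ?R)" for P' :: "'a program"
    using intp by (simp_all add: SM_iff reduct_model_plus)
  have ratio: "Pr (P' + ?R) ?Y / Pr (P' + ?R) {} = W P' ?Y 0 / W P' {} 0"
    if "no_hard_rules P'" for P' :: "'a program"
  proof -
    have "no_hard_rules (P' + ?R)"
      using that no_hard_rules_zero_facts[of ?Y] by (auto simp: no_hard_rules_def)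
    then show ?thesis using Pr_ratio[OF _ SM] by (simp add: W_plus W_zero_facts)
  qed
  have "Pr (P + ?R) X = Pr (Q + ?R) X" if "X \<in> SM (P + ?R)" for X
    by (rule p_uniformly_equivalent_Pr[OF eq weighted_facts_zero_facts that])
  then have "W P ?Y 0 / W P {} 0 = W Q ?Y 0 / W Q {} 0"
    using ratio[OF soft(1)] ratio[OF soft(2)] SM[of P] by simp
  then have "W P ?Y 0 = W P {} 0 / W Q {} 0 * W Q ?Y 0"
    using W_pos[of P "{}" 0] W_pos[of Q "{}" 0] by (simp add: field_simps)
  moreover have "W P ?Y 0 = W P Y 0" "W Q ?Y 0 = W Q Y 0"
    using W_cong[OF L(2), of ?Y Y] W_cong[OF L(3), of ?Y Y] by auto
  ultimately show ?thesis by simp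
qed

section \<open>From UE-models and weights to p-uniform equivalence\<close>

lemma UE_eq_imp_p_uniformly_equivalent:
  assumes UE: "UE P = UE Q"
    and W: "\<And>Y \<alpha>. interpretation_set Y \<Longrightarrow> W P Y \<alpha> = c * W Q Y \<alpha>"
  shows "p_uniformly_equivalent P Q"
  unfolding p_uniformly_equivalent_def
proof (intro allI impI conjI ballI)
  fix R :: "'a program" assume R: "weighted_facts R"
  show SM: "SM (P + R) = SM (Q + R)"
    by (rule set_eqI) (simp add: SM_plus_facts_iff[OF R] UE)
  have "interpretation_set ({} :: 'a interp)" by (simp add: interpretation_set_def)
  \<comment> \<open>Weights are positive, so \<open>c\<close> is nonzero and cancels between the
    numerator and the normalising sum below.\<close>
  then have "c \<noteq> 0" using W[of "{}" 0] W_pos[of P "{}" 0] by auto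
  have WR: "W (P + R) I \<alpha> = c * W (Q + R) I \<alpha>" if "I \<in> SM (Q + R)" for I \<alpha>
    using W that by (simp add: W_plus SM_iff)
  fix X assume "X \<in> SM (P + R)"
  then have X: "X \<in> SM (Q + R)" using SM by simp
  have "W (P + R) X \<alpha> / (\<Sum>I\<in>SM (Q + R). W (P + R) I \<alpha>) =
      W (Q + R) X \<alpha> / (\<Sum>I\<in>SM (Q + R). W (Q + R) I \<alpha>)" for \<alpha>
    using \<open>c \<noteq> 0\<close> X by (simp add: WR sum_distrib_left[symmetric])
  then show "Pr (P + R) X = Pr (Q + R) X"
    by (simp add: Pr_def SM)
qed

theorem theorem4p16:
  fixes P Q :: "'a program"
  assumes "no_hard_rules P" and "no_hard_rules Q"
  shows "p_uniformly_equivalent P Q \<longleftrightarrow>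
    UE P = UE Q \<and>
    (\<exists>c::real. \<forall>(X, Y)\<in>UE P. \<forall>\<alpha>. W_SE P (X, Y) \<alpha> = c * W_SE Q (X, Y) \<alpha>)"
proof (intro iffI conjI)
  assume eq: "p_uniformly_equivalent P Q"
  show "UE P = UE Q"
    using p_uniformly_equivalent_UE_subset eq p_uniformly_equivalent_sym by blast
  have "W P Y \<alpha> = W P {} 0 / W Q {} 0 * W Q Y \<alpha>" if "(X, Y) \<in> UE P" for X Y \<alpha>
    using p_uniformly_equivalent_weight_ratio[OF eq assms, of Y] that
      W_no_hard_rules[OF assms(1), of Y \<alpha>] W_no_hard_rules[OF assms(2), of Y \<alpha>]
    by (simp add: UE_iff SE_iff)
  then show "\<exists>c::real. \<forall>(X, Y)\<in>UE P. \<forall>\<alpha>. W_SE P (X, Y) \<alpha> = c * W_SE Q (X, Y) \<alpha>"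
    by (intro exI[of _ "W P {} 0 / W Q {} 0"]) (auto simp: W_SE_def)
next
  assume "UE P = UE Q \<and>
    (\<exists>c::real. \<forall>(X, Y)\<in>UE P. \<forall>\<alpha>. W_SE P (X, Y) \<alpha> = c * W_SE Q (X, Y) \<alpha>)"
  then obtain c where UE: "UE P = UE Q"
    and c: "\<forall>(X, Y)\<in>UE P. \<forall>\<alpha>. W_SE P (X, Y) \<alpha> = c * W_SE Q (X, Y) \<alpha>"
    by blast
  \<comment> \<open>The weight condition reaches every interpretation \<open>Y\<close> because
    \<open>(Y, Y)\<close> is always a UE-model.\<close>
  have "W P Y \<alpha> = c * W Q Y \<alpha>" if "interpretation_set Y" for Y \<alpha>
    using bspec[OF c UE_refl[OF that]] by (simp add: W_SE_def)
  then show "p_uniformly_equivalent P Q"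
    by (rule UE_eq_imp_p_uniformly_equivalent[OF UE])
qed

end
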